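(* Let $f,h:E^3\times\mathbb{R}\to\mathbb{R}$ be bounded (measurable) functions. For a time interval $[t_1,t_2]$ of length $T=t_2-t_1>0$ put $$\langle f(x^i,t)\rangle_T=\frac1T\int_{t_1}^{t_2} f(x^i,t+t')\,dt',\qquad \langle f(x^i,t)h(y^j,s)\rangle_T=\frac1T\int_{t_1}^{t_2} f(x^i,t+t')\,h(y^j,s+t')\,dt'.$$ Consider a family of intervals $[t_1,t_2]$ with $T\to\infty$, and assume that the limits below exist. Then: (a) the time average over an infinitely large time interval does not depend on time: for every $x$, $\lim_{T\to\infty}\langle f(x^i,t)\rangle_T$ is independent of $t$; (b) the two-point second order time correlation function over an infinitely large time interval depends on $t,s$ only through $s-t$: there is a function $B$ with $$\lim_{T\to\infty}\langle f(x^i,t)h(y^j,s)\rangle_T=B(x^i,y^j;s-t)$$ for all $x,y\in E^3$ and $t,s\in\mathbb{R}$.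
   Context: $E^3$ is three-dimensional Euclidean space. The endpoints $t_1,t_2$ are regarded as functions of the parameter $T=t_2-t_1$, the same interval $[t_1,t_2]$ being used for all reference points $x,y$ and times $t,s$. *)

theory Defs
  imports "HOL-Analysis.Analysis"
begin

definition time_average ::
  "real \<Rightarrow> real \<Rightarrow> ((real ^ 3) \<times> real \<Rightarrow> real) \<Rightarrow> real ^ 3 \<Rightarrow> real \<Rightarrow> real" where
  "time_average a b f x t =
     1 / (b - a) * (LINT u:{a..b}|lebesgue. f (x, t + u))"

definition time_correlation ::
  "real \<Rightarrow> real \<Rightarrow> ((real ^ 3) \<times> real \<Rightarrow> real) \<Rightarrow> ((real ^ 3) \<times> real \<Rightarrow> real) \<Rightarrow>
     real ^ 3 \<Rightarrow> real ^ 3 \<Rightarrow> real \<Rightarrow> real \<Rightarrow> real" where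
  "time_correlation a b f h x y t s =
     1 / (b - a) * (LINT u:{a..b}|lebesgue. f (x, t + u) * h (y, s + u))"

text \<open>Only the time sections are integrated, so measurability is required of them rather than of
  the function on the product: every jointly Borel measurable function qualifies, whereas joint
  Lebesgue measurability alone would not make every time average meaningful.\<close>

definition time_measurable :: "((real ^ 3) \<times> real \<Rightarrow> real) \<Rightarrow> bool" where
  "time_measurable f \<longleftrightarrow> (\<forall>x. (\<lambda>t. f (x, t)) \<in> borel_measurable lebesgue)"

end

theory Submission
  imports Defs
begin

text \<open>Translating the integrand by \<open>c\<close> amounts to translating the interval of integration, which
  changes the integral only over two end pieces of length \<open>\<bar>c\<bar>\<close>. For an integrand bounded by \<open>M\<close> the
  averages therefore differ by at most \<open>2 * M * \<bar>c\<bar> / T\<close>, which vanishes as \<open>T\<close> tends to infinity.\<close>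

text \<open>Continuity of the translation is not enough: the composition also needs preimages of
  Lebesgue null sets to be Lebesgue measurable, which holds for nondegenerate affine maps.\<close>

lemma borel_measurable_lebesgue_translate:
  fixes g :: "real \<Rightarrow> real"
  assumes "g \<in> borel_measurable lebesgue"
  shows "(\<lambda>u. g (c + u)) \<in> borel_measurable lebesgue"
proof -
  \<comment> \<open>The translation is written as an affine map with scaling factor 1 in every
    coordinate; on the reals the sum collapses to \<open>u\<close>.\<close>
  have "(\<lambda>u::real. c + (\<Sum>j\<in>Basis. (1 * (u \<bullet> j)) *\<^sub>R j)) \<in> lebesgue \<rightarrow>\<^sub>M lebesgue"
    by (rule lebesgue_affine_measurable) simp
  then have "(\<lambda>u::real. c + u) \<in> lebesgue \<rightarrow>\<^sub>M lebesgue"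
    by simp
  from measurable_compose[OF this assms] show ?thesis .
qed

lemma set_integrable_lebesgue_bounded:
  fixes g :: "real \<Rightarrow> real"
  assumes "g \<in> borel_measurable lebesgue" and "\<And>u. \<bar>g u\<bar> \<le> M"
  shows "set_integrable lebesgue {a..b} g"
  unfolding set_integrable_def
proof (rule Bochner_Integration.integrable_bound)
  show "integrable lebesgue (\<lambda>u. indicator {a..b} u *\<^sub>R M)"
    by (intro integrable_scaleR_left integrable_real_indicator) (auto simp: emeasure_lborel_Icc_eq)
  show "(\<lambda>u. indicator {a..b} u *\<^sub>R g u) \<in> borel_measurable lebesgue"
    by (intro borel_measurable_scaleR borel_measurable_indicator assms(1)) auto
  show "AE u in lebesgue. norm (indicator {a..b} u *\<^sub>R g u) \<le> norm (indicator {a..b} u *\<^sub>R M)"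
    using order_trans[OF assms(2) abs_ge_self] by (auto simp: indicator_def)
qed

lemma set_lebesgue_integral_translate_diff_le_nonneg:
  fixes g :: "real \<Rightarrow> real"
  assumes meas: "g \<in> borel_measurable lebesgue" and bound: "\<And>u. \<bar>g u\<bar> \<le> M"
    and "a \<le> b" and "0 \<le> c"
  shows "\<bar>(LINT u:{a..b}|lebesgue. g (c + u)) - (LINT u:{a..b}|lebesgue. g u)\<bar> \<le> 2 * M * c"
proof -
  \<comment> \<open>From here on the argument uses gauge integrals, which are convenient for
    shifting and subdividing intervals.\<close>
  have int: "g integrable_on {p..q}" for p q
    using set_integrable_lebesgue_bounded[OF meas bound] by (rule set_lebesgue_integral_eq_integral)
  have small: "\<bar>integral {p..p + c} g\<bar> \<le> M * c" for p
  proof -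
    have "0 \<le> M"
      using bound[of 0] by linarith
    then show ?thesis
      using has_integral_bound_real[of M "{}", OF _ _ integrable_integral[OF int[of p "p + c"]]]
        bound \<open>0 \<le> c\<close> by simp
  qed
  have "(LINT u:{a..b}|lebesgue. g u) = integral {a..b} g"
    by (rule set_lebesgue_integral_eq_integral set_integrable_lebesgue_bounded meas bound)+
  moreover have "(LINT u:{a..b}|lebesgue. g (c + u)) = integral {a..b} (\<lambda>u. g (c + u))"
    using set_integrable_lebesgue_bounded[OF borel_measurable_lebesgue_translate[OF meas] bound]
    by (rule set_lebesgue_integral_eq_integral)
  moreover have "integral {a..b} (\<lambda>u. g (c + u)) = integral {a + c..b + c} g"
    using integral_shift_Icc_real[of a b g c] by (simp add: o_def)
  \<comment> \<open>Splitting \<open>{a..b + c}\<close> at \<open>b\<close> and at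
    \<open>a + c\<close> and comparing leaves only the end pieces at \<open>a\<close> and
    \<open>b\<close>, each at most \<open>M * c\<close> in absolute value. Both cuts lie inside the
    interval even if \<open>c\<close> exceeds \<open>b - a\<close>.\<close>
  moreover have "integral {a..b} g + integral {b..b + c} g = integral {a..b + c} g"
    using assms int by (intro Henstock_Kurzweil_Integration.integral_combine) auto
  moreover have "integral {a..a + c} g + integral {a + c..b + c} g = integral {a..b + c} g"
    using assms int by (intro Henstock_Kurzweil_Integration.integral_combine) auto
  ultimately show ?thesis
    using small[of a] small[of b] by linarith
qed

lemma set_lebesgue_integral_translate_diff_le:
  fixes g :: "real \<Rightarrow> real"
  assumes meas: "g \<in> borel_measurable lebesgue" and bound: "\<And>u. \<bar>g u\<bar> \<le> M" and "a \<le> b"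
  shows "\<bar>(LINT u:{a..b}|lebesgue. g (c + u)) - (LINT u:{a..b}|lebesgue. g u)\<bar> \<le> 2 * M * \<bar>c\<bar>"
proof (cases "0 \<le> c")
  case True
  then show ?thesis
    using set_lebesgue_integral_translate_diff_le_nonneg[OF assms] by simp
next
  case False
  \<comment> \<open>For negative \<open>c\<close> the roles are swapped: translating
    \<open>\<lambda>u. g (c + u)\<close> by the positive amount \<open>- c\<close> gives back
    \<open>g\<close>.\<close>
  then show ?thesis
    using set_lebesgue_integral_translate_diff_le_nonneg
        [OF borel_measurable_lebesgue_translate[OF meas, of c] bound \<open>a \<le> b\<close>, of "- c"]
    by (simp add: abs_minus_commute)
qed

text \<open>Both claims reduce to this: a change of reference time is a translation of the
  integrand, and the limit survives it.\<close>

lemma tendsto_average_translate: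
  fixes g :: "real \<Rightarrow> real"
  assumes meas: "g \<in> borel_measurable lebesgue" and bound: "\<And>u. \<bar>g u\<bar> \<le> M"
    and len: "\<And>T. T > 0 \<Longrightarrow> t2 T - t1 T = T"
    and lim: "((\<lambda>T. 1 / (t2 T - t1 T) * (LINT u:{t1 T..t2 T}|lebesgue. g u)) \<longlongrightarrow> L) at_top"
  shows "((\<lambda>T. 1 / (t2 T - t1 T) * (LINT u:{t1 T..t2 T}|lebesgue. g (c + u))) \<longlongrightarrow> L) at_top"
proof (rule Lim_transform[OF lim])
  have "\<forall>\<^sub>F T in at_top.
      norm (1 / (t2 T - t1 T) * (LINT u:{t1 T..t2 T}|lebesgue. g (c + u)) -
        1 / (t2 T - t1 T) * (LINT u:{t1 T..t2 T}|lebesgue. g u)) \<le> 2 * M * \<bar>c\<bar> / T"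
    \<comment> \<open>The endpoints are constrained only for positive \<open>T\<close>, so the
      estimate is an eventual one.\<close>
    using eventually_gt_at_top[of "0::real"]
  proof eventually_elim
    case (elim T)
    then have "t1 T \<le> t2 T"
      using len[of T] by simp
    from set_lebesgue_integral_translate_diff_le[OF meas bound this, of c] elim
    show ?case
      by (simp add: len abs_divide divide_right_mono flip: diff_divide_distrib)
  qed
  moreover have "((\<lambda>T. 2 * M * \<bar>c\<bar> / T) \<longlongrightarrow> 0) at_top"
    by (intro real_tendsto_divide_at_top[OF tendsto_const] filterlim_ident)
  ultimately show "((\<lambda>T. 1 / (t2 T - t1 T) * (LINT u:{t1 T..t2 T}|lebesgue. g (c + u)) -
      1 / (t2 T - t1 T) * (LINT u:{t1 T..t2 T}|lebesgue. g u)) \<longlongrightarrow> 0) at_top"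
    by (rule Lim_null_comparison)
qed

theorem theorem2:
  fixes f h :: "(real ^ 3) \<times> real \<Rightarrow> real"
    and t1 t2 :: "real \<Rightarrow> real"
  assumes "bounded (range f)" and "bounded (range h)"
    and "time_measurable f" and "time_measurable h"
    and "\<And>T. T > 0 \<Longrightarrow> t2 T - t1 T = T"
    and "\<And>x t. \<exists>L. ((\<lambda>T. time_average (t1 T) (t2 T) f x t) \<longlongrightarrow> L) at_top"
    and "\<And>x y t s. \<exists>L. ((\<lambda>T. time_correlation (t1 T) (t2 T) f h x y t s) \<longlongrightarrow> L) at_top"
  shows "(\<forall>x. \<exists>A. \<forall>t. ((\<lambda>T. time_average (t1 T) (t2 T) f x t) \<longlongrightarrow> A) at_top) \<and>
    (\<exists>B. \<forall>x y t s.
      ((\<lambda>T. time_correlation (t1 T) (t2 T) f h x y t s) \<longlongrightarrow> B x y (s - t)) at_top)"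
proof -
  from assms(1,2) obtain M N where M: "\<And>p. \<bar>f p\<bar> \<le> M" and N: "\<And>p. \<bar>h p\<bar> \<le> N"
    by (auto simp: bounded_iff)
  have mf: "(\<lambda>u. f (x, u)) \<in> borel_measurable lebesgue"
    and mh: "(\<lambda>u. h (x, u)) \<in> borel_measurable lebesgue" for x
    using assms(3,4) by (auto simp: time_measurable_def)
  have "\<exists>A. \<forall>t. ((\<lambda>T. time_average (t1 T) (t2 T) f x t) \<longlongrightarrow> A) at_top" for x
  proof -
    \<comment> \<open>Time 0 serves as the reference; every other \<open>t\<close> is a translate of
      it.\<close>
    from assms(6) obtain A where A: "((\<lambda>T. time_average (t1 T) (t2 T) f x 0) \<longlongrightarrow> A) at_top"
      by blast
    have "((\<lambda>T. time_average (t1 T) (t2 T) f x t) \<longlongrightarrow> A) at_top" for t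
      using mf M assms(5) A unfolding time_average_def add_0_left
      by (rule tendsto_average_translate)
    then show ?thesis by blast
  qed
  moreover
  \<comment> \<open>The only possible value of \<open>B\<close> at lag \<open>r\<close> is the limit
    at the times 0 and \<open>r\<close>; it is chosen for each \<open>x\<close>, \<open>y\<close>,
    \<open>r\<close> from the assumed existence.\<close>
  define B where
    "B x y r = (SOME L. ((\<lambda>T. time_correlation (t1 T) (t2 T) f h x y 0 r) \<longlongrightarrow> L) at_top)" for x y r
  have B: "((\<lambda>T. time_correlation (t1 T) (t2 T) f h x y 0 r) \<longlongrightarrow> B x y r) at_top" for x y r
    unfolding B_def using assms(7) by (rule someI_ex)
  have "((\<lambda>T. time_correlation (t1 T) (t2 T) f h x y t s) \<longlongrightarrow> B x y (s - t)) at_top" for x y t s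
  proof -
    \<comment> \<open>The lag is built into one function of time: \<open>?g u\<close> is the
      integrand for the times 0 and \<open>s - t\<close>, while \<open>?g (t + u)\<close> is the one
      for \<open>t\<close> and \<open>s\<close>, since
      \<open>(s - t) + (t + u) = s + u\<close>.\<close>
    let ?g = "\<lambda>u. f (x, u) * h (y, (s - t) + u)"
    have "?g \<in> borel_measurable lebesgue"
      by (intro borel_measurable_times mf borel_measurable_lebesgue_translate[OF mh])
    moreover have "\<bar>?g u\<bar> \<le> M * N" for u
      unfolding abs_mult using order_trans[OF abs_ge_zero M] by (intro mult_mono M N) auto
    ultimately have
      "((\<lambda>T. 1 / (t2 T - t1 T) * (LINT u:{t1 T..t2 T}|lebesgue. ?g (t + u))) \<longlongrightarrow> B x y (s - t)) at_top"
      using assms(5) B[of x y "s - t"] unfolding time_correlation_def add_0_left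
      by (rule tendsto_average_translate)
    then show ?thesis
      by (simp add: time_correlation_def)
  qed
  ultimately show ?thesis by blast
qed

end
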